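(* For all integers $a,b\ge2$, the $1$-subdivision $\operatorname{sub}(K_{a,b})$ of $K_{a,b}$ satisfies the operator-norm Sidorenko certificate. In particular, for every $t\ge2$ and every graph $G$ with adjacency matrix $A(G)$, $$\hom(\operatorname{sub}(K_{t,t}),G)\ge\|A(G)\|_{\frac{4t}{3t-2}\to\frac{4t}{t+2}}^{2t^2}.$$
   Context: Graphs are finite and simple. $\hom(H,G)$ is the number of homomorphisms from $H$ to $G$. The $1$-subdivision $\operatorname{sub}(H)$ is obtained from $H$ by subdividing every edge exactly once. For a real $n\times n$ matrix $A$ and $1\le p,r\le\infty$, $\|A\|_{p\to r}:=\sup_{x\ne0}\|Ax\|_r/\|x\|_p$. Operator-norm Sidorenko certificate: a bipartite graph $F$ with $v$ vertices and $e$ edges, $v\le e$, satisfies it if for every graph $G$ with adjacency matrix $A$, $\hom(F,G)\ge\|A\|_{s_F'\to s_F}^{e}$, where $s_F=\frac{2e}{v}$ and $s_F'=\frac{2e}{2e-v}$. *)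

theory Defs
  imports "HOL-Analysis.Analysis" "Graph_Theory.Kuratowski"
begin

text \<open>
  A finite simple graph is a \<^locale>\<open>pair_graph\<close>: a symmetric loop-free digraph in which every
  undirected edge contributes both of its orientations to \<^const>\<open>parcs\<close>. Edges are therefore
  counted as two-element vertex sets.
\<close>

definition edges :: "'a pair_pre_digraph \<Rightarrow> 'a set set" where
  "edges G = (\<lambda>(u, v). {u, v}) ` parcs G"

definition bipartite :: "'a pair_pre_digraph \<Rightarrow> bool" where
  "bipartite G \<longleftrightarrow> (\<exists>U W. pverts G = U \<union> W \<and> U \<inter> W = {} \<and> parcs G \<subseteq> U \<times> W \<union> W \<times> U)"

definition hom_set :: "'a pair_pre_digraph \<Rightarrow> 'b pair_pre_digraph \<Rightarrow> ('a \<Rightarrow> 'b) set" where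
  "hom_set H G = {f \<in> pverts H \<rightarrow>\<^sub>E pverts G. \<forall>(u, v) \<in> parcs H. (f u, f v) \<in> parcs G}"

definition hom_count :: "'a pair_pre_digraph \<Rightarrow> 'b pair_pre_digraph \<Rightarrow> nat" where
  "hom_count H G = card (hom_set H G)"

text \<open>The vertex subdividing an edge \<open>e\<close> is \<open>Inr e\<close>; it is joined to both endpoints of \<open>e\<close>.\<close>

definition one_subdivision :: "'a pair_pre_digraph \<Rightarrow> ('a + 'a set) pair_pre_digraph" where
  "one_subdivision H =
     \<lparr> pverts = Inl ` pverts H \<union> Inr ` edges H,
       parcs = {(Inl u, Inr e) | u e. e \<in> edges H \<and> u \<in> e} \<union>
               {(Inr e, Inl u) | u e. e \<in> edges H \<and> u \<in> e} \<rparr>"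

definition adjacency :: "'a pair_pre_digraph \<Rightarrow> 'a \<Rightarrow> 'a \<Rightarrow> real" where
  "adjacency G u v = (if (u, v) \<in> parcs G then 1 else 0)"

text \<open>
  Vectors and square matrices are indexed by a finite set \<open>S\<close>; values outside \<open>S\<close> are irrelevant.
  Exponents range over \<open>[1, \<infinity>]\<close>, a part of \<^typ>\<open>ennreal\<close>.
\<close>

definition lp_norm :: "ennreal \<Rightarrow> 'i set \<Rightarrow> ('i \<Rightarrow> real) \<Rightarrow> real" where
  "lp_norm p S x =
     (if p = \<infinity> then Max ((\<lambda>i. \<bar>x i\<bar>) ` S)
      else (\<Sum>i\<in>S. \<bar>x i\<bar> powr enn2real p) powr (1 / enn2real p))"

definition mat_vec :: "'i set \<Rightarrow> ('i \<Rightarrow> 'i \<Rightarrow> real) \<Rightarrow> ('i \<Rightarrow> real) \<Rightarrow> 'i \<Rightarrow> real" where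
  "mat_vec S A x = (\<lambda>i. \<Sum>j\<in>S. A i j * x j)"

text \<open>
  The supremum is taken in \<^typ>\<open>ennreal\<close>, where it is never a junk value; for empty \<open>S\<close> it is the
  supremum of the empty set, which is \<open>0\<close> there.
\<close>

definition op_norm :: "ennreal \<Rightarrow> ennreal \<Rightarrow> 'i set \<Rightarrow> ('i \<Rightarrow> 'i \<Rightarrow> real) \<Rightarrow> ennreal" where
  "op_norm p r S A =
     (SUP x \<in> {x. \<exists>i\<in>S. x i \<noteq> 0}. ennreal (lp_norm r S (mat_vec S A x) / lp_norm p S x))"

text \<open>
  The type argument gives the vertex type of the target graphs \<open>G\<close>; for an infinite type such as
  \<^typ>\<open>nat\<close> these are all finite graphs up to isomorphism.
\<close>

definition op_norm_certificate :: "'g itself \<Rightarrow> 'f pair_pre_digraph \<Rightarrow> bool" where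
  "op_norm_certificate (T :: 'g itself) F \<longleftrightarrow>
     pair_graph F \<and> bipartite F \<and> card (pverts F) \<le> card (edges F) \<and>
     (let v = real (card (pverts F));
          e = card (edges F);
          s = 2 * real e / v;
          s' = 2 * real e / (2 * real e - v)
      in \<forall>G :: 'g pair_pre_digraph. pair_graph G \<longrightarrow>
           of_nat (hom_count F G) \<ge> op_norm (ennreal s') (ennreal s) (pverts G) (adjacency G) ^ e)"

end

theory Submission
  imports Defs
begin

text \<open>
  Let \<open>A\<close> be the adjacency matrix of \<open>G\<close> and \<open>M = A\<^sup>2\<close>. Then \<open>N = hom (sub K\<^sub>a\<^sub>b, G)\<close> is the sum of
  \<open>\<Prod>\<^sub>i \<Prod>\<^sub>j M x\<^sub>i y\<^sub>j\<close> over all \<open>a\<close>-tuples \<open>x\<close> and \<open>b\<close>-tuples \<open>y\<close> of vertices. Applying Hoelder's inequality once for each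
  side of \<open>K\<^sub>a\<^sub>b\<close> bounds the form \<open>\<langle>x, M y\<rangle>\<close> by \<open>N\<close> to the power \<open>1/(ab)\<close> in the norms with
  reciprocal exponents \<open>1 - 1/b\<close> and \<open>1 - 1/a\<close>. As \<open>M\<close> is symmetric, interpolation allows both
  to be replaced by their mean \<open>\<theta>\<close>. Since \<open>\<langle>x, M x\<rangle>\<close> is the square of the Euclidean norm of
  \<open>A x\<close>, the form of \<open>A\<close> is bounded by \<open>N\<close> to the power \<open>1/(2ab)\<close> at \<open>\<theta>\<close> and \<open>1/2\<close>, and
  interpolating once more gives the mean of \<open>\<theta>\<close> and \<open>1/2\<close>, which is the reciprocal of the exponent
  \<open>s'\<close> of the certificate. The conjugate of \<open>s'\<close> is \<open>s\<close>, so duality finishes the proof.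
\<close>

section \<open>Hoelder's inequality and bilinear bounds\<close>

text \<open>Once both sums are normalised to 1, Young's inequality applies to each index, and its
  right-hand sides add up to \<open>\<theta> + \<phi> = 1\<close>. The summands \<open>f\<close> and
  \<open>g\<close> stand for the powers of the usual formulation, so only reciprocal exponents
  occur.\<close>

lemma Holder_inequality_sum:
  fixes f g :: "'i \<Rightarrow> real"
  assumes "\<theta> > 0" "\<phi> > 0" "\<theta> + \<phi> = 1"
    and f: "\<And>i. i \<in> S \<Longrightarrow> f i \<ge> 0" and g: "\<And>i. i \<in> S \<Longrightarrow> g i \<ge> 0"
  shows "(\<Sum>i\<in>S. f i powr \<theta> * g i powr \<phi>) \<le> (\<Sum>i\<in>S. f i) powr \<theta> * (\<Sum>i\<in>S. g i) powr \<phi>"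
\<comment> \<open>Normalising needs nonzero sums. A sum over an infinite set is 0 by convention;
  over a finite set a zero sum makes every factor \<open>f i\<close> or every factor
  \<open>g i\<close> vanish, hence every product.\<close>
proof (cases "finite S \<and> (\<Sum>i\<in>S. f i) \<noteq> 0 \<and> (\<Sum>i\<in>S. g i) \<noteq> 0")
  case False
  then have "(\<Sum>i\<in>S. f i powr \<theta> * g i powr \<phi>) = 0"
    using f g by (auto simp: sum_nonneg_eq_0_iff)
  then show ?thesis by simp
next
  case True
  define F G where "F = (\<Sum>i\<in>S. f i)" and "G = (\<Sum>i\<in>S. g i)"
  have FG: "F > 0" "G > 0"
    using True f g by (auto simp: F_def G_def sum_nonneg less_le)
  have "f i powr \<theta> * g i powr \<phi> \<le> F powr \<theta> * G powr \<phi> * (\<theta> * (f i / F) + \<phi> * (g i / G))"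
    if i: "i \<in> S" for i
  proof -
    have "(f i / F) powr \<theta> * (g i / G) powr \<phi> \<le> \<theta> * (f i / F) + \<phi> * (g i / G)"
    proof (cases "f i = 0 \<or> g i = 0")
      case True
      then show ?thesis using f[OF i] g[OF i] FG assms by auto
    next
      case False
      then show ?thesis
        using f[OF i] g[OF i] FG assms by (intro Youngs_inequality_0) auto
    qed
    then have "F powr \<theta> * G powr \<phi> * ((f i / F) powr \<theta> * (g i / G) powr \<phi>)
        \<le> F powr \<theta> * G powr \<phi> * (\<theta> * (f i / F) + \<phi> * (g i / G))"
      by (intro mult_left_mono) auto
    then show ?thesis
      using f[OF i] g[OF i] FG by (simp add: powr_divide)
  qed
  then have "(\<Sum>i\<in>S. f i powr \<theta> * g i powr \<phi>)
      \<le> (\<Sum>i\<in>S. F powr \<theta> * G powr \<phi> * (\<theta> * (f i / F) + \<phi> * (g i / G)))"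
    by (rule sum_mono)
  also have "\<dots> = F powr \<theta> * G powr \<phi> * (\<theta> * (\<Sum>i\<in>S. f i / F) + \<phi> * (\<Sum>i\<in>S. g i / G))"
    by (simp only: sum.distrib flip: sum_distrib_left)
  also have "\<dots> = F powr \<theta> * G powr \<phi>"
    using FG assms by (simp flip: sum_divide_distrib F_def G_def)
  finally show ?thesis by (simp add: F_def G_def)
qed

text \<open>
  With \<open>\<theta> = 1/p\<close>, \<open>\<phi> = 1/q\<close>, this says that the form \<open>\<langle>x, M y\<rangle>\<close> is at most
  \<open>K * lp_norm p S x * lp_norm q S y\<close> for nonnegative \<open>x = f\<^sup>\<theta>\<close>, \<open>y = g\<^sup>\<phi>\<close>; in terms of
  \<open>f\<close> and \<open>g\<close> interpolation is just Hoelder's inequality.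
\<close>

definition bilinear_bound :: "'i set \<Rightarrow> ('i \<Rightarrow> 'i \<Rightarrow> real) \<Rightarrow> real \<Rightarrow> real \<Rightarrow> real \<Rightarrow> bool" where
  "bilinear_bound S M \<theta> \<phi> K \<longleftrightarrow>
     (\<forall>f g. (\<forall>i\<in>S. 0 \<le> f i) \<longrightarrow> (\<forall>i\<in>S. 0 \<le> g i) \<longrightarrow>
        (\<Sum>u\<in>S. \<Sum>v\<in>S. M u v * f u powr \<theta> * g v powr \<phi>)
          \<le> K * (\<Sum>i\<in>S. f i) powr \<theta> * (\<Sum>i\<in>S. g i) powr \<phi>)"

lemma bilinear_boundD:
  assumes "bilinear_bound S M \<theta> \<phi> K" "\<And>i. i \<in> S \<Longrightarrow> 0 \<le> f i" "\<And>i. i \<in> S \<Longrightarrow> 0 \<le> g i"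
  shows "(\<Sum>u\<in>S. \<Sum>v\<in>S. M u v * f u powr \<theta> * g v powr \<phi>)
           \<le> K * (\<Sum>i\<in>S. f i) powr \<theta> * (\<Sum>i\<in>S. g i) powr \<phi>"
  using assms by (auto simp: bilinear_bound_def)

section \<open>Interpolation of bilinear forms\<close>

text \<open>Each summand at the mean exponent is the geometric mean of the summands at
  \<open>(\<theta>, \<phi>)\<close> and at \<open>(\<phi>, \<theta>)\<close>. Cauchy-Schwarz bounds
  the sum by the geometric mean of the two forms, and both have bound \<open>K\<close>, the second
  by symmetry of \<open>M\<close>.\<close>

lemma bilinear_bound_midpoint:
  assumes nonneg: "\<And>u v. u \<in> S \<Longrightarrow> v \<in> S \<Longrightarrow> M u v \<ge> 0"
    and sym: "\<And>u v. u \<in> S \<Longrightarrow> v \<in> S \<Longrightarrow> M u v = M v u"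
    and "K \<ge> 0" and bound: "bilinear_bound S M \<theta> \<phi> K"
  shows "bilinear_bound S M ((\<theta> + \<phi>) / 2) ((\<theta> + \<phi>) / 2) K"
  unfolding bilinear_bound_def
proof (intro allI impI)
  fix f g :: "'a \<Rightarrow> real"
  assume fg: "\<forall>i\<in>S. 0 \<le> f i" "\<forall>i\<in>S. 0 \<le> g i"
  define \<tau> where "\<tau> = (\<theta> + \<phi>) / 2"
  define F where "F = (\<lambda>(u, v). M u v * f u powr \<theta> * g v powr \<phi>)"
  define G where "G = (\<lambda>(u, v). M u v * f u powr \<phi> * g v powr \<theta>)"
  define a b where "a = (\<Sum>i\<in>S. f i)" and "b = (\<Sum>i\<in>S. g i)"
  have split: "x powr (\<theta> / 2) * x powr (\<phi> / 2) = x powr \<tau>" for x :: real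
    by (simp add: \<tau>_def add_divide_distrib flip: powr_add)
  have half: "x powr (1/2) * x powr (1/2) = x" if "x \<ge> 0" for x :: real
    using that by (simp flip: powr_add)
  have "(\<Sum>u\<in>S. \<Sum>v\<in>S. M u v * f u powr \<tau> * g v powr \<tau>) =
      (\<Sum>p\<in>S\<times>S. F p powr (1/2) * G p powr (1/2))"
    unfolding sum.cartesian_product
  proof (rule sum.cong, goal_cases)
    case (2 p)
    obtain u v where p: "p = (u, v)" by force
    have "F p powr (1/2) * G p powr (1/2) =
        (M u v powr (1/2) * M u v powr (1/2)) * (f u powr (\<theta> / 2) * f u powr (\<phi> / 2))
          * (g v powr (\<theta> / 2) * g v powr (\<phi> / 2))"
      using 2 fg nonneg by (simp add: p F_def G_def powr_mult powr_powr)
    then show ?case using 2 nonneg by (simp add: p split half)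
  qed auto
  also have "\<dots> \<le> (\<Sum>p\<in>S\<times>S. F p) powr (1/2) * (\<Sum>p\<in>S\<times>S. G p) powr (1/2)"
    using fg nonneg by (intro Holder_inequality_sum) (auto simp: F_def G_def)
  also have "\<dots> \<le> (K * a powr \<theta> * b powr \<phi>) powr (1/2) * (K * b powr \<theta> * a powr \<phi>) powr (1/2)"
  proof (intro mult_mono powr_mono2)
    show "(\<Sum>p\<in>S\<times>S. F p) \<le> K * a powr \<theta> * b powr \<phi>"
      using bilinear_boundD[OF bound] fg
      by (simp add: F_def a_def b_def flip: sum.cartesian_product)
    \<comment> \<open>Transposing \<open>M\<close> puts \<open>g\<close> into the slot with exponent
      \<open>\<theta>\<close>, so the hypothesis applies with \<open>f\<close> and \<open>g\<close>
      exchanged.\<close>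
    have "(\<Sum>p\<in>S\<times>S. G p) = (\<Sum>u\<in>S. \<Sum>v\<in>S. M u v * g u powr \<theta> * f v powr \<phi>)"
      by (subst sum.swap)
        (auto simp: G_def mult_ac sym simp flip: sum.cartesian_product intro!: sum.cong)
    also have "\<dots> \<le> K * b powr \<theta> * a powr \<phi>"
      using bilinear_boundD[OF bound, of g f] fg by (simp add: a_def b_def)
    finally show "(\<Sum>p\<in>S\<times>S. G p) \<le> K * b powr \<theta> * a powr \<phi>" .
  qed (use nonneg in \<open>auto intro!: sum_nonneg simp: F_def G_def\<close>)
  also have "\<dots> = (K powr (1/2) * K powr (1/2)) * (a powr (\<theta> / 2) * a powr (\<phi> / 2))
          * (b powr (\<theta> / 2) * b powr (\<phi> / 2))"
    using \<open>K \<ge> 0\<close> fg by (simp add: a_def b_def powr_mult powr_powr sum_nonneg)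
  also have "\<dots> = K * a powr \<tau> * b powr \<tau>"
    using \<open>K \<ge> 0\<close> by (simp add: split half)
  finally show "(\<Sum>u\<in>S. \<Sum>v\<in>S. M u v * f u powr ((\<theta> + \<phi>) / 2) * g v powr ((\<theta> + \<phi>) / 2))
      \<le> K * (\<Sum>i\<in>S. f i) powr ((\<theta> + \<phi>) / 2) * (\<Sum>i\<in>S. g i) powr ((\<theta> + \<phi>) / 2)"
    by (simp add: \<tau>_def a_def b_def)
qed

text \<open>The \<open>TT*\<close> argument: with \<open>h\<close> the transpose of \<open>A\<close>
  applied to \<open>f powr \<theta>\<close>, the squared Euclidean norm of \<open>h\<close> is the
  given form with \<open>f\<close> in both slots, which is why both exponents have to be equal.
  Cauchy-Schwarz then pairs \<open>h\<close> with \<open>g powr (1/2)\<close>.\<close>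

lemma bilinear_bound_of_square:
  assumes nonneg: "\<And>u v. u \<in> S \<Longrightarrow> v \<in> S \<Longrightarrow> A u v \<ge> 0"
    and "K \<ge> 0"
    and bound: "bilinear_bound S (\<lambda>u v. \<Sum>w\<in>S. A u w * A v w) \<theta> \<theta> K"
  shows "bilinear_bound S A \<theta> (1/2) (K powr (1/2))"
  unfolding bilinear_bound_def
proof (intro allI impI)
  fix f g :: "'a \<Rightarrow> real"
  assume fg: "\<forall>i\<in>S. 0 \<le> f i" "\<forall>i\<in>S. 0 \<le> g i"
  define h where "h w = (\<Sum>u\<in>S. A u w * f u powr \<theta>)" for w
  have h: "h w \<ge> 0" if "w \<in> S" for w
    using that nonneg by (auto simp: h_def intro!: sum_nonneg)
  have "(\<Sum>w\<in>S. (h w)\<^sup>2) =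
      (\<Sum>u\<in>S. \<Sum>v\<in>S. (\<Sum>w\<in>S. A u w * A v w) * f u powr \<theta> * f v powr \<theta>)"
    unfolding h_def power2_eq_square sum_product sum_distrib_right
    by (subst sum.swap, rule sum.cong[OF refl], subst sum.swap) (simp add: mult_ac sum_distrib_left)
  also have "\<dots> \<le> K * (\<Sum>i\<in>S. f i) powr \<theta> * (\<Sum>i\<in>S. f i) powr \<theta>"
    using bilinear_boundD[OF bound, of f f] fg by blast
  finally have sq: "(\<Sum>w\<in>S. (h w)\<^sup>2) \<le> K * (\<Sum>i\<in>S. f i) powr \<theta> * (\<Sum>i\<in>S. f i) powr \<theta>" .
  have "(\<Sum>u\<in>S. \<Sum>v\<in>S. A u v * f u powr \<theta> * g v powr (1/2)) =
      (\<Sum>w\<in>S. ((h w)\<^sup>2) powr (1/2) * g w powr (1/2))"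
    by (subst sum.swap, rule sum.cong)
      (use h in \<open>auto simp: h_def powr_half_sqrt sum_distrib_right\<close>)
  also have "\<dots> \<le> (\<Sum>w\<in>S. (h w)\<^sup>2) powr (1/2) * (\<Sum>w\<in>S. g w) powr (1/2)"
    using fg by (intro Holder_inequality_sum) auto
  also have "\<dots> \<le> (K * (\<Sum>i\<in>S. f i) powr \<theta> * (\<Sum>i\<in>S. f i) powr \<theta>) powr (1/2) * (\<Sum>w\<in>S. g w) powr (1/2)"
    using sq by (intro mult_right_mono powr_mono2) (auto intro!: sum_nonneg)
  also have "\<dots> = K powr (1/2) * (\<Sum>i\<in>S. f i) powr \<theta> * (\<Sum>w\<in>S. g w) powr (1/2)"
    using \<open>K \<ge> 0\<close> by (simp add: powr_mult powr_powr flip: powr_add)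
  finally show "(\<Sum>u\<in>S. \<Sum>v\<in>S. A u v * f u powr \<theta> * g v powr (1/2))
      \<le> K powr (1/2) * (\<Sum>i\<in>S. f i) powr \<theta> * (\<Sum>w\<in>S. g w) powr (1/2)" .
qed

section \<open>Duality between bilinear forms and operator norms\<close>

text \<open>The exponents \<open>1 / \<tau>\<close> and \<open>r = 1 / (1 - \<tau>)\<close> are
  conjugate. Testing the form on the extremal vector \<open>h powr (r - 1)\<close>, where
  \<open>h\<close> is \<open>A\<close> applied to the absolute values of \<open>x\<close>, bounds
  \<open>Z\<close>, the \<open>r\<close>-th power of the norm of \<open>h\<close>, by a multiple of
  \<open>Z powr \<tau>\<close>, which is divided out.\<close>

lemma op_norm_le_of_bilinear_bound:
  fixes A :: "'i \<Rightarrow> 'i \<Rightarrow> real"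
  assumes "finite S" and nonneg: "\<And>u v. u \<in> S \<Longrightarrow> v \<in> S \<Longrightarrow> A u v \<ge> 0"
    and \<tau>: "0 < \<tau>" "\<tau> < 1" and bound: "bilinear_bound S A \<tau> \<tau> K"
  shows "op_norm (ennreal (1 / \<tau>)) (ennreal (1 / (1 - \<tau>))) S A \<le> ennreal K"
  unfolding op_norm_def
proof (rule SUP_least)
  fix x :: "'i \<Rightarrow> real"
  assume "x \<in> {x. \<exists>i\<in>S. x i \<noteq> 0}"
  then obtain i where i: "i \<in> S" "x i \<noteq> 0" by auto
  define r where "r = 1 / (1 - \<tau>)"
  have r: "r > 0" "1 / r = 1 - \<tau>" "r * \<tau> + 1 = r"
    using \<tau> by (auto simp: r_def field_simps)
  define y where "y v = \<bar>x v\<bar> powr (1 / \<tau>)" for v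
  define Y where "Y = (\<Sum>v\<in>S. y v)"
  define h where "h u = (\<Sum>v\<in>S. A u v * \<bar>x v\<bar>)" for u
  define Z where "Z = (\<Sum>u\<in>S. h u powr r)"
  have y: "y v powr \<tau> = \<bar>x v\<bar>" for v
    using \<tau> by (simp add: y_def powr_powr)
  have "Y > 0"
    unfolding Y_def by (rule sum_pos2[of _ i]) (use i \<open>finite S\<close> in \<open>auto simp: y_def\<close>)
  have h: "h u \<ge> 0" if "u \<in> S" for u
    using that nonneg by (auto simp: h_def intro!: sum_nonneg)
  have "Z \<ge> 0" by (simp add: Z_def sum_nonneg)
  have expand: "(\<Sum>v\<in>S. A u v * c * y v powr \<tau>) = c * h u" for u c
    by (simp add: h_def y sum_distrib_left mult_ac)
  \<comment> \<open>Since \<open>r * \<tau> = r - 1\<close>, the extremal vector corresponds to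
    \<open>f = h powr r\<close> in the form.\<close>
  have "Z = (\<Sum>u\<in>S. (h u powr r) powr \<tau> * h u)"
    unfolding Z_def
  proof (rule sum.cong)
    fix u assume "u \<in> S"
    have "h u powr r = h u powr (r * \<tau> + 1)" by (simp add: r)
    also have "\<dots> = (h u powr r) powr \<tau> * h u"
      using h[OF \<open>u \<in> S\<close>] by (simp add: powr_add powr_powr)
    finally show "h u powr r = (h u powr r) powr \<tau> * h u" .
  qed auto
  also have "\<dots> = (\<Sum>u\<in>S. \<Sum>v\<in>S. A u v * (h u powr r) powr \<tau> * y v powr \<tau>)"
    by (simp only: expand)
  also have "\<dots> \<le> K * Z powr \<tau> * Y powr \<tau>"
    unfolding Z_def Y_def by (rule bilinear_boundD[OF bound]) (auto simp: y_def)
  finally have Z: "Z \<le> K * Z powr \<tau> * Y powr \<tau>" .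
  \<comment> \<open>Using \<open>max K 0\<close> settles the case \<open>Z = 0\<close> without first
    deriving the sign of \<open>K\<close>. As \<open>ennreal\<close> truncates negative reals to 0,
    the final bound is still \<open>ennreal K\<close>.\<close>
  have Z': "Z powr (1 - \<tau>) \<le> max K 0 * Y powr \<tau>"
  proof (cases "Z = 0")
    case False
    then have "Z powr (1 - \<tau>) * Z powr \<tau> = Z" using \<open>Z \<ge> 0\<close> by (simp flip: powr_add)
    then have "Z powr (1 - \<tau>) * Z powr \<tau> \<le> (K * Y powr \<tau>) * Z powr \<tau>"
      using Z by (simp add: mult_ac)
    then have "Z powr (1 - \<tau>) \<le> K * Y powr \<tau>"
      by (rule mult_right_le_imp_le) (use False \<open>Z \<ge> 0\<close> in auto)
    also have "\<dots> \<le> max K 0 * Y powr \<tau>"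
      by (intro mult_right_mono) auto
    finally show ?thesis .
  qed auto
  have "lp_norm (ennreal r) S (mat_vec S A x) = (\<Sum>u\<in>S. \<bar>mat_vec S A x u\<bar> powr r) powr (1 - \<tau>)"
    using r by (simp add: lp_norm_def)
  also have "\<dots> \<le> Z powr (1 - \<tau>)"
    unfolding Z_def
  proof (intro powr_mono2 sum_mono)
    fix u assume "u \<in> S"
    then show "\<bar>mat_vec S A x u\<bar> \<le> h u"
      unfolding mat_vec_def h_def using nonneg
      by (intro order_trans[OF sum_abs] sum_mono) (auto simp: abs_mult)
  qed (use r \<tau> in \<open>auto intro: sum_nonneg\<close>)
  finally have "lp_norm (ennreal r) S (mat_vec S A x) \<le> max K 0 * Y powr \<tau>"
    using Z' by simp
  moreover have "lp_norm (ennreal (1 / \<tau>)) S x = Y powr \<tau>"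
    using \<tau> by (simp add: lp_norm_def Y_def y_def)
  ultimately have "lp_norm (ennreal r) S (mat_vec S A x) / lp_norm (ennreal (1 / \<tau>)) S x \<le> max K 0"
    using \<open>Y > 0\<close> by (simp add: divide_le_eq)
  then have "ennreal (lp_norm (ennreal r) S (mat_vec S A x) / lp_norm (ennreal (1 / \<tau>)) S x)
      \<le> ennreal (max K 0)"
    by (rule ennreal_leI)
  then show "ennreal (lp_norm (ennreal (1 / (1 - \<tau>))) S (mat_vec S A x)
      / lp_norm (ennreal (1 / \<tau>)) S x) \<le> ennreal K"
    by (simp add: r_def max_def ennreal_neg split: if_splits)
qed

section \<open>Weighted counts of complete bipartite graphs\<close>

text \<open>The constant is a root of the number of homomorphisms from a complete bipartite graph,
  weighted by \<open>M\<close>: \<open>V\<close> indexes one side, and summing out the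
  \<open>a\<close> vertices of the other side gives the \<open>a\<close>-th power. One use of
  Hoelder removes \<open>f\<close> and leaves a sum of powers \<open>h u ^ b\<close>; a second
  removes \<open>g\<close> from that sum.\<close>

lemma bilinear_bound_complete_bipartite:
  assumes "finite S" and nonneg: "\<And>u v. u \<in> S \<Longrightarrow> v \<in> S \<Longrightarrow> M u v \<ge> 0"
    and "finite V" and ab: "a \<ge> 2" "card V \<ge> 2"
  shows "bilinear_bound S M (1 - 1 / real (card V)) (1 - 1 / real a)
    ((\<Sum>y\<in>V \<rightarrow>\<^sub>E S. (\<Sum>u\<in>S. \<Prod>j\<in>V. M u (y j)) ^ a) powr (1 / (real a * real (card V))))"
  unfolding bilinear_bound_def
proof (intro allI impI)
  fix f g :: "'a \<Rightarrow> real"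
  assume fg: "\<forall>i\<in>S. 0 \<le> f i" "\<forall>i\<in>S. 0 \<le> g i"
  define b where "b = card V"
  define \<theta> \<phi> where "\<theta> = 1 - 1 / real b" and "\<phi> = 1 - 1 / real a"
  have b: "b \<ge> 2" using ab by (simp add: b_def)
  have exps: "\<theta> > 0" "\<phi> > 0" using ab b by (auto simp: \<theta>_def \<phi>_def)
  define h where "h u = (\<Sum>v\<in>S. M u v * g v powr \<phi>)" for u
  have h: "h u \<ge> 0" if "u \<in> S" for u
    using that nonneg by (auto simp: h_def intro!: sum_nonneg)
  define C where "C y = (\<Sum>u\<in>S. \<Prod>j\<in>V. M u (y j))" for y :: "'b \<Rightarrow> 'a"
  have C: "C y \<ge> 0" if "y \<in> V \<rightarrow>\<^sub>E S" for y
    unfolding C_def using that nonneg by (intro sum_nonneg prod_nonneg ballI) (auto simp: PiE_iff)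
  define N where "N = (\<Sum>y\<in>V \<rightarrow>\<^sub>E S. C y ^ a)"
  have root: "(x ^ n) powr (1 / real n) = x" if "x \<ge> 0" "n \<ge> 2" for x :: real and n :: nat
    using that by (cases "x = 0") (auto simp: powr_powr simp flip: powr_realpow)
  \<comment> \<open>Expanding the power over tuples \<open>y\<close> and summing over
    \<open>u\<close> first separates \<open>C y\<close> from a product of values of
    \<open>g\<close>. Writing \<open>C y\<close> as a root of \<open>C y ^ a\<close> prepares
    Hoelder with exponents \<open>\<phi>\<close> and \<open>1/a\<close>.\<close>
  have "(\<Sum>u\<in>S. h u ^ b) = (\<Sum>u\<in>S. \<Sum>y\<in>V \<rightarrow>\<^sub>E S. \<Prod>j\<in>V. M u (y j) * g (y j) powr \<phi>)"
  proof (rule sum.cong)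
    fix u
    have "h u ^ b = (\<Prod>j\<in>V. \<Sum>v\<in>S. M u v * g v powr \<phi>)"
      by (simp add: h_def b_def)
    also have "\<dots> = (\<Sum>y\<in>V \<rightarrow>\<^sub>E S. \<Prod>j\<in>V. M u (y j) * g (y j) powr \<phi>)"
      using \<open>finite S\<close> \<open>finite V\<close> by (intro prod_sum_PiE)
    finally show "h u ^ b = (\<Sum>y\<in>V \<rightarrow>\<^sub>E S. \<Prod>j\<in>V. M u (y j) * g (y j) powr \<phi>)" .
  qed auto
  also have "\<dots> = (\<Sum>y\<in>V \<rightarrow>\<^sub>E S. (\<Prod>j\<in>V. g (y j)) powr \<phi> * (C y ^ a) powr (1 / real a))"
  proof (subst sum.swap, rule sum.cong, goal_cases)
    case (2 y)
    have "(\<Sum>u\<in>S. \<Prod>j\<in>V. M u (y j) * g (y j) powr \<phi>) = C y * (\<Prod>j\<in>V. g (y j)) powr \<phi>"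
      using 2 fg by (subst prod_powr_distrib) (auto simp: C_def prod.distrib sum_distrib_right PiE_iff)
    then show ?case using C[OF 2] ab by (simp add: root)
  qed auto
  also have "\<dots> \<le> (\<Sum>y\<in>V \<rightarrow>\<^sub>E S. \<Prod>j\<in>V. g (y j)) powr \<phi> * N powr (1 / real a)"
    unfolding N_def using exps ab fg C
    by (intro Holder_inequality_sum) (auto simp: \<phi>_def PiE_iff intro!: prod_nonneg)
  \<comment> \<open>The coordinates of \<open>y\<close> are independent, so the sum of products is a
    power.\<close>
  also have "(\<Sum>y\<in>V \<rightarrow>\<^sub>E S. \<Prod>j\<in>V. g (y j)) = (\<Sum>v\<in>S. g v) ^ b"
    using prod_sum_PiE[of V "\<lambda>_. S" "\<lambda>_. g"] \<open>finite S\<close> \<open>finite V\<close> by (simp add: b_def)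
  finally have hb: "(\<Sum>u\<in>S. h u ^ b) \<le> ((\<Sum>v\<in>S. g v) ^ b) powr \<phi> * N powr (1 / real a)" .
  \<comment> \<open>Here Hoelder has exponents \<open>\<theta>\<close> and \<open>1/b\<close>, which
    is what brings in the \<open>b\<close>-th powers of \<open>h\<close> bounded above.\<close>
  have "(\<Sum>u\<in>S. \<Sum>v\<in>S. M u v * f u powr \<theta> * g v powr \<phi>) =
      (\<Sum>u\<in>S. f u powr \<theta> * (h u ^ b) powr (1 / real b))"
    using h b by (intro sum.cong refl) (simp add: root, simp add: h_def sum_distrib_left mult_ac)
  also have "\<dots> \<le> (\<Sum>u\<in>S. f u) powr \<theta> * (\<Sum>u\<in>S. h u ^ b) powr (1 / real b)"
    using exps b fg h by (intro Holder_inequality_sum) (auto simp: \<theta>_def)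
  also have "\<dots> \<le> (\<Sum>u\<in>S. f u) powr \<theta>
      * (((\<Sum>v\<in>S. g v) ^ b) powr \<phi> * N powr (1 / real a)) powr (1 / real b)"
    using hb h by (intro mult_left_mono powr_mono2) (auto intro!: sum_nonneg)
  also have "(((\<Sum>v\<in>S. g v) ^ b) powr \<phi> * N powr (1 / real a)) powr (1 / real b)
      = (((\<Sum>v\<in>S. g v) ^ b) powr (1 / real b)) powr \<phi> * N powr (1 / (real a * real b))"
    by (simp add: powr_mult powr_powr mult_ac)
  also have "((\<Sum>v\<in>S. g v) ^ b) powr (1 / real b) = (\<Sum>v\<in>S. g v)"
    using fg b by (intro root sum_nonneg) auto
  finally show "(\<Sum>u\<in>S. \<Sum>v\<in>S. M u v * f u powr (1 - 1 / real (card V)) * g v powr (1 - 1 / real a))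
      \<le> (\<Sum>y\<in>V \<rightarrow>\<^sub>E S. (\<Sum>u\<in>S. \<Prod>j\<in>V. M u (y j)) ^ a) powr (1 / (real a * real (card V)))
        * (\<Sum>u\<in>S. f u) powr (1 - 1 / real (card V)) * (\<Sum>v\<in>S. g v) powr (1 - 1 / real a)"
    by (simp add: \<theta>_def \<phi>_def b_def N_def C_def mult_ac)
qed

section \<open>Homomorphisms from a subdivision\<close>

text \<open>Subdividing vertices are pairwise nonadjacent. Once the original vertices are placed by
  \<open>\<phi>\<close>, each edge independently chooses a common neighbour of the images of its
  ends.\<close>

lemma hom_count_one_subdivision:
  assumes H: "finite (pverts H)" "finite (edges H)" and G: "pair_graph G"
  shows "hom_count (one_subdivision H) G =
    (\<Sum>\<phi>\<in>pverts H \<rightarrow>\<^sub>E pverts G. \<Prod>e\<in>edges H. card {w \<in> pverts G. \<forall>u\<in>e. (\<phi> u, w) \<in> parcs G})"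
proof -
  interpret pair_graph G by fact
  have sym: "(v, u) \<in> parcs G" if "(u, v) \<in> parcs G" for u v
    using pair_sym_arcs that by (auto simp: symmetric_def dest: symD)
  define W where "W \<phi> e = {w \<in> pverts G. \<forall>u\<in>e. (\<phi> u, w) \<in> parcs G}" for \<phi> :: "'a \<Rightarrow> 'b" and e
  let ?T = "SIGMA \<phi>:pverts H \<rightarrow>\<^sub>E pverts G. \<Pi>\<^sub>E e\<in>edges H. W \<phi> e"
  have hom: "hom_set (one_subdivision H) G =
      {f \<in> Inl ` pverts H \<union> Inr ` edges H \<rightarrow>\<^sub>E pverts G.
         \<forall>e\<in>edges H. \<forall>u\<in>e. (f (Inl u), f (Inr e)) \<in> parcs G}"
    unfolding hom_set_def one_subdivision_def by (auto dest: sym)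
  have "bij_betw (\<lambda>(\<phi>, \<psi>). case_sum \<phi> \<psi>) ?T (hom_set (one_subdivision H) G)"
  proof (rule bij_betw_byWitness[where f' = "\<lambda>f. (f \<circ> Inl, f \<circ> Inr)"])
    have "case_sum \<phi> \<psi> \<in> hom_set (one_subdivision H) G"
      if \<phi>: "\<phi> \<in> pverts H \<rightarrow>\<^sub>E pverts G" and \<psi>: "\<psi> \<in> (\<Pi>\<^sub>E e\<in>edges H. W \<phi> e)" for \<phi> \<psi>
    proof -
      \<comment> \<open>Membership in the function space requires the default value outside the
        domain; it is inherited from \<open>\<phi>\<close> and \<open>\<psi>\<close> on their
        summands.\<close>
      have "case_sum \<phi> \<psi> z = undefined" if "z \<notin> Inl ` pverts H \<union> Inr ` edges H" for z
        using that \<phi> \<psi> by (cases z) (auto simp: PiE_iff extensional_def)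
      moreover have "\<psi> e \<in> pverts G" "\<forall>u\<in>e. (\<phi> u, \<psi> e) \<in> parcs G" if "e \<in> edges H" for e
        using PiE_mem[OF \<psi> that] by (simp_all add: W_def)
      ultimately show ?thesis
        using \<phi> by (auto simp: hom PiE_iff extensional_def)
    qed
    then show "(\<lambda>(\<phi>, \<psi>). case_sum \<phi> \<psi>) ` ?T \<subseteq> hom_set (one_subdivision H) G"
      by auto
    show "(\<lambda>f. (f \<circ> Inl, f \<circ> Inr)) ` hom_set (one_subdivision H) G \<subseteq> ?T"
    proof (rule image_subsetI)
      fix f assume f: "f \<in> hom_set (one_subdivision H) G"
      then have "f \<circ> Inl \<in> pverts H \<rightarrow>\<^sub>E pverts G"
        by (auto simp: hom PiE_iff extensional_def)
      moreover have "f \<circ> Inr \<in> (\<Pi>\<^sub>E e\<in>edges H. W (f \<circ> Inl) e)"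
        using f by (auto simp: hom PiE_iff extensional_def W_def)
      ultimately show "(f \<circ> Inl, f \<circ> Inr) \<in> ?T" by blast
    qed
  qed (auto simp: fun_eq_iff split: sum.splits)
  then have "hom_count (one_subdivision H) G = card ?T"
    by (simp add: hom_count_def bij_betw_same_card)
  also have "\<dots> = (\<Sum>\<phi>\<in>pverts H \<rightarrow>\<^sub>E pverts G. card (\<Pi>\<^sub>E e\<in>edges H. W \<phi> e))"
    using H pair_finite_verts by (intro card_SigmaI finite_PiE ballI) (auto simp: W_def)
  finally show ?thesis
    using H by (simp add: card_PiE W_def)
qed

section \<open>Structure and size of a subdivision\<close>

lemma pair_graph_one_subdivision:
  assumes "pair_graph H"
  shows "pair_graph (one_subdivision H)"
proof -
  interpret pair_graph H by fact
  have E: "finite (edges H)" "\<And>e. e \<in> edges H \<Longrightarrow> e \<subseteq> pverts H"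
    using pair_finite_arcs by (auto simp: edges_def dest: in_arcsD1 in_arcsD2)
  have "parcs (one_subdivision H) \<subseteq> pverts (one_subdivision H) \<times> pverts (one_subdivision H)"
    using E by (auto simp: one_subdivision_def)
  moreover have finite_verts: "finite (pverts (one_subdivision H))"
    using E pair_finite_verts by (simp add: one_subdivision_def)
  ultimately have finite_arcs: "finite (parcs (one_subdivision H))"
    using finite_subset by blast
  show ?thesis
    using finite_verts finite_arcs
    by unfold_locales
      (auto simp: symmetric_def sym_def one_subdivision_def intro: E(2)[THEN subsetD])
qed

lemma bipartite_one_subdivision:
  assumes "pair_graph H"
  shows "bipartite (one_subdivision H)"
proof -
  interpret pair_graph H by fact
  have "e \<subseteq> pverts H" if "e \<in> edges H" for e
    using that by (auto simp: edges_def dest: in_arcsD1 in_arcsD2)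
  then show ?thesis
    unfolding bipartite_def
    by (intro exI[of _ "Inl ` pverts H"] exI[of _ "Inr ` edges H"]) (auto simp: one_subdivision_def)
qed

lemma card_verts_one_subdivision:
  assumes "finite (pverts H)" "finite (edges H)"
  shows "card (pverts (one_subdivision H)) = card (pverts H) + card (edges H)"
  using assms by (subst one_subdivision_def) (auto simp: card_image intro!: card_Un_disjoint[THEN trans])

text \<open>Edges of the subdivision correspond to incidences of a vertex with an edge of
  \<open>H\<close>; the tags \<open>Inl\<close> and \<open>Inr\<close> make this injective. Absence
  of loops gives each edge exactly two ends.\<close>

lemma card_edges_one_subdivision:
  assumes "pair_graph H"
  shows "card (edges (one_subdivision H)) = 2 * card (edges H)"
proof -
  interpret pair_graph H by fact
  have E: "finite (edges H)" "\<And>e. e \<in> edges H \<Longrightarrow> card e = 2"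
    using pair_finite_arcs pair_no_loops by (auto simp: edges_def card_2_iff) force
  have "edges (one_subdivision H) = (\<lambda>(e, u). {Inl u, Inr e}) ` (SIGMA e:edges H. e)"
    unfolding edges_def[of "one_subdivision H"] by (force simp: one_subdivision_def image_iff)
  moreover have "inj_on (\<lambda>(e, u). {Inl u, Inr e}) (SIGMA e:edges H. e)"
    by (auto simp: inj_on_def doubleton_eq_iff)
  ultimately have "card (edges (one_subdivision H)) = card (SIGMA e:edges H. e)"
    by (simp add: card_image)
  also have "\<dots> = (\<Sum>e\<in>edges H. card e)"
    using E by (intro card_SigmaI) (auto intro: card_ge_0_finite)
  finally show ?thesis using E by simp
qed

section \<open>Subdivided complete bipartite graphs\<close>

text \<open>Disjoint sides let an unordered edge determine its end in each side, so a product over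
  edges becomes a double product over \<open>U\<close> and \<open>V\<close>.\<close>

lemma edges_complete_bipartite:
  assumes "parcs H = U \<times> V \<union> V \<times> U" "U \<inter> V = {}"
  shows "bij_betw (\<lambda>(u, v). {u, v}) (U \<times> V) (edges H)"
proof -
  have "edges H = (\<lambda>(u, v). {u, v}) ` (U \<times> V)"
    using assms(1) by (force simp: edges_def image_iff doubleton_eq_iff)
  then show ?thesis
    using assms(2) by (auto simp: bij_betw_def inj_on_def doubleton_eq_iff)
qed

lemma sum_PiE_Un_disjoint:
  assumes "U \<inter> V = {}"
  shows "(\<Sum>\<phi>\<in>U \<union> V \<rightarrow>\<^sub>E S. F (restrict \<phi> U) (restrict \<phi> V)) =
    (\<Sum>x\<in>U \<rightarrow>\<^sub>E S. \<Sum>y\<in>V \<rightarrow>\<^sub>E S. F x y)"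
  unfolding sum.cartesian_product
  by (rule sum.reindex_bij_witness[where
        i = "\<lambda>(x, y) i. if i \<in> U then x i else y i" and
        j = "\<lambda>\<phi>. (restrict \<phi> U, restrict \<phi> V)"])
    (use assms in \<open>auto simp: PiE_iff extensional_def fun_eq_iff restrict_def\<close>)

text \<open>\<open>M u v\<close> counts the common neighbours of \<open>u\<close> and
  \<open>v\<close>. This identifies the homomorphism count with the sum in
  \<open>bilinear_bound_complete_bipartite\<close>.\<close>

lemma hom_count_one_subdivision_complete_bipartite:
  fixes H :: "'a pair_pre_digraph" and G :: "'b pair_pre_digraph"
  assumes H: "pverts H = U \<union> V" "parcs H = U \<times> V \<union> V \<times> U" "U \<inter> V = {}" "finite U" "finite V"
    and G: "pair_graph G"
  defines "S \<equiv> pverts G"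
  defines "M \<equiv> \<lambda>u v. \<Sum>w\<in>S. adjacency G u w * adjacency G v w"
  shows "real (hom_count (one_subdivision H) G) =
    (\<Sum>y\<in>V \<rightarrow>\<^sub>E S. (\<Sum>u\<in>S. \<Prod>j\<in>V. M u (y j)) ^ card U)"
proof -
  interpret pair_graph G by fact
  have bij: "bij_betw (\<lambda>(u, v). {u, v}) (U \<times> V) (edges H)"
    using H by (intro edges_complete_bipartite)
  then have "finite (edges H)"
    using H bij_betw_finite by blast
  have S: "finite S" using pair_finite_verts by (simp add: S_def)
  have M: "real (card {w \<in> S. (\<phi> u, w) \<in> parcs G \<and> (\<phi> v, w) \<in> parcs G}) = M (\<phi> u) (\<phi> v)"
    for u v :: 'a and \<phi>
    using S by (simp add: M_def adjacency_def sum.If_cases Int_def flip: of_bool_def of_bool_conj)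
  have "real (hom_count (one_subdivision H) G) =
      (\<Sum>\<phi>\<in>U \<union> V \<rightarrow>\<^sub>E S. \<Prod>e\<in>edges H. real (card {w \<in> S. \<forall>u\<in>e. (\<phi> u, w) \<in> parcs G}))"
    using H G \<open>finite (edges H)\<close> by (simp add: hom_count_one_subdivision S_def)
  also have "\<dots> = (\<Sum>\<phi>\<in>U \<union> V \<rightarrow>\<^sub>E S. \<Prod>i\<in>U. \<Prod>j\<in>V. M (restrict \<phi> U i) (restrict \<phi> V j))"
    by (simp add: M prod.cartesian_product case_prod_unfold flip: prod.reindex_bij_betw[OF bij])
  also have "\<dots> = (\<Sum>y\<in>V \<rightarrow>\<^sub>E S. \<Sum>x\<in>U \<rightarrow>\<^sub>E S. \<Prod>i\<in>U. \<Prod>j\<in>V. M (x i) (y j))"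
    using H by (subst sum_PiE_Un_disjoint[where F = "\<lambda>x y. \<Prod>i\<in>U. \<Prod>j\<in>V. M (x i) (y j)"])
      (auto intro: sum.swap)
  \<comment> \<open>For fixed \<open>y\<close> the images of the vertices in \<open>U\<close> vary
    independently; the factors are equal and form the power with exponent
    \<open>card U\<close>.\<close>
  also have "\<dots> = (\<Sum>y\<in>V \<rightarrow>\<^sub>E S. \<Prod>i\<in>U. \<Sum>u\<in>S. \<Prod>j\<in>V. M u (y j))"
    using H S by (intro sum.cong refl prod_sum_PiE[symmetric])
  finally show ?thesis by simp
qed

section \<open>The operator-norm inequality and the certificate\<close>

lemma op_norm_adjacency_le_hom_count:
  fixes H :: "'a pair_pre_digraph" and G :: "'b pair_pre_digraph"
  assumes H: "pverts H = U \<union> V" "parcs H = U \<times> V \<union> V \<times> U" "U \<inter> V = {}" "finite U" "finite V"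
    and ab: "card U = a" "card V = b" "a \<ge> 2" "b \<ge> 2"
    and G: "pair_graph G"
  defines "\<tau> \<equiv> 3/4 - (1 / real a + 1 / real b) / 4"
  shows "op_norm (ennreal (1 / \<tau>)) (ennreal (1 / (1 - \<tau>))) (pverts G) (adjacency G) ^ (2 * (a * b))
    \<le> of_nat (hom_count (one_subdivision H) G)"
proof -
  interpret pair_graph G by fact
  define S where "S = pverts G"
  define A where "A = adjacency G"
  define M where "M u v = (\<Sum>w\<in>S. A u w * A v w)" for u v
  define N where "N = real (hom_count (one_subdivision H) G)"
  have "finite S" using pair_finite_verts by (simp add: S_def)
  have A: "A u v \<ge> 0" "A u v = A v u" for u v
    using pair_sym_arcs by (auto simp: A_def adjacency_def symmetric_def dest: symD)
  have M: "M u v \<ge> 0" "M u v = M v u" for u v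
    using A(1) by (auto simp: M_def mult.commute intro!: sum_nonneg)
  have \<tau>: "0 < \<tau>" "\<tau> < 1"
  proof -
    define p q where "p = 1 / real a" and "q = 1 / real b"
    have "p \<le> 1/2" "q \<le> 1/2" "p > 0" "q > 0"
      using ab by (auto simp: p_def q_def field_simps)
    then show "0 < \<tau>" "\<tau> < 1"
      by (simp_all add: \<tau>_def field_simps flip: p_def q_def)
  qed
  have "N = (\<Sum>y\<in>V \<rightarrow>\<^sub>E S. (\<Sum>u\<in>S. \<Prod>j\<in>V. M u (y j)) ^ a)"
    using hom_count_one_subdivision_complete_bipartite[OF H G] ab
    by (simp add: N_def M_def S_def A_def)
  then have "bilinear_bound S M (1 - 1 / real b) (1 - 1 / real a) (N powr (1 / (real a * real b)))"
    using bilinear_bound_complete_bipartite[of S M V a] \<open>finite S\<close> M(1) H ab by simp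
  then have "bilinear_bound S M ((1 - 1 / real b + (1 - 1 / real a)) / 2)
      ((1 - 1 / real b + (1 - 1 / real a)) / 2) (N powr (1 / (real a * real b)))"
    using M by (intro bilinear_bound_midpoint) auto
  then have "bilinear_bound S A ((1 - 1 / real b + (1 - 1 / real a)) / 2) (1/2)
      ((N powr (1 / (real a * real b))) powr (1/2))"
    unfolding M_def using A by (intro bilinear_bound_of_square) auto
  then have "bilinear_bound S A (((1 - 1 / real b + (1 - 1 / real a)) / 2 + 1/2) / 2)
      (((1 - 1 / real b + (1 - 1 / real a)) / 2 + 1/2) / 2) ((N powr (1 / (real a * real b))) powr (1/2))"
    using A by (intro bilinear_bound_midpoint) auto
  \<comment> \<open>Two midpoint steps produce this exponent, first for \<open>M\<close> and then,
    against \<open>1/2\<close>, for \<open>A\<close>.\<close>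
  also have "((1 - 1 / real b + (1 - 1 / real a)) / 2 + 1/2) / 2 = \<tau>"
    by (simp add: \<tau>_def field_simps)
  also have "(N powr (1 / (real a * real b))) powr (1/2) = N powr (1 / real (2 * (a * b)))"
    by (simp add: powr_powr mult_ac)
  finally have "bilinear_bound S A \<tau> \<tau> (N powr (1 / real (2 * (a * b))))" .
  then have "op_norm (ennreal (1 / \<tau>)) (ennreal (1 / (1 - \<tau>))) S A
      \<le> ennreal (N powr (1 / real (2 * (a * b))))"
    using \<open>finite S\<close> A(1) \<tau> by (intro op_norm_le_of_bilinear_bound)
  then have "op_norm (ennreal (1 / \<tau>)) (ennreal (1 / (1 - \<tau>))) S A ^ (2 * (a * b))
      \<le> ennreal (N powr (1 / real (2 * (a * b)))) ^ (2 * (a * b))"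
    by (intro power_mono) auto
  also have "\<dots> = ennreal ((N powr (1 / real (2 * (a * b)))) ^ (2 * (a * b)))"
    by (rule ennreal_power) simp
  \<comment> \<open>The case \<open>N = 0\<close> is separate because turning a power into
    \<open>powr\<close> needs a positive base; there the positive exponent makes both sides
    0.\<close>
  also have "(N powr (1 / real (2 * (a * b)))) ^ (2 * (a * b)) = N"
  proof -
    have "2 * (a * b) > 0" using ab by simp
    then show ?thesis
      by (cases "N = 0") (auto simp: powr_powr N_def simp flip: powr_realpow)
  qed
  finally show ?thesis by (simp add: N_def S_def A_def ennreal_of_nat_eq_real_of_nat)
qed

text \<open>With \<open>v = a + b + a * b\<close> and \<open>e = 2 * (a * b)\<close>, the ratio
  \<open>v / (2 * e)\<close> equals \<open>1 - \<tau>\<close>, so the exponents of the certificate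
  are those of the operator-norm bound. The two counts are also conclusions so that the case
  \<open>a = b = t\<close> can evaluate the exponents.\<close>

lemma op_norm_certificate_one_subdivision_complete_bipartite:
  fixes H :: "'f pair_pre_digraph"
  assumes ab: "a \<ge> 2" "b \<ge> 2" and K: "complete_bipartite_digraph a b (with_proj H)"
  shows "op_norm_certificate TYPE('g) (one_subdivision H)"
    and "card (pverts (one_subdivision H)) = a + b + a * b"
    and "card (edges (one_subdivision H)) = 2 * (a * b)"
proof -
  have "pair_graph H" using K by (rule pair_graphI_complete_bipartite)
  then interpret pair_graph H .
  obtain U V where H: "pverts H = U \<union> V" "parcs H = U \<times> V \<union> V \<times> U" "U \<inter> V = {}"
      and UV: "card U = a" "card V = b"
    using K by (auto simp: complete_bipartite_digraph_pair_def)
  have fin: "finite U" "finite V" using H pair_finite_verts by auto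
  have "card (edges H) = a * b"
    using bij_betw_same_card[OF edges_complete_bipartite[OF H(2,3)]] UV
    by (simp add: card_cartesian_product)
  moreover have "finite (edges H)" using pair_finite_arcs by (simp add: edges_def)
  ultimately show v: "card (pverts (one_subdivision H)) = a + b + a * b"
    and e: "card (edges (one_subdivision H)) = 2 * (a * b)"
    using card_verts_one_subdivision[of H] card_edges_one_subdivision[OF \<open>pair_graph H\<close>]
      H fin UV pair_finite_verts by (auto simp: card_Un_disjoint)
  have ve: "a + b \<le> a * b"
  proof -
    \<comment> \<open>The right-hand side equals \<open>a * b - a - b\<close>; integers avoid
      truncated subtraction.\<close>
    have "0 \<le> (int a - 2) * (int b - 1) + (int b - 2)" using ab by simp
    then have "int (a + b) \<le> int (a * b)" by (simp add: algebra_simps)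
    then show ?thesis by (simp only: of_nat_le_iff)
  qed
  define \<tau> where "\<tau> = 3/4 - (1 / real a + 1 / real b) / 4"
  have exps: "2 * real (2 * (a * b)) / real (a + b + a * b) = 1 / (1 - \<tau>)"
    "2 * real (2 * (a * b)) / (2 * real (2 * (a * b)) - real (a + b + a * b)) = 1 / \<tau>"
  proof -
    have "real a > 0" "real b > 0" using ab by auto
    then have "\<tau> = (2 * real (2 * (a * b)) - real (a + b + a * b)) / (2 * real (2 * (a * b)))"
      "1 - \<tau> = real (a + b + a * b) / (2 * real (2 * (a * b)))"
      by (auto simp: \<tau>_def field_simps)
    then show "2 * real (2 * (a * b)) / real (a + b + a * b) = 1 / (1 - \<tau>)"
      "2 * real (2 * (a * b)) / (2 * real (2 * (a * b)) - real (a + b + a * b)) = 1 / \<tau>"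
      by simp_all
  qed
  have "op_norm (ennreal (1 / \<tau>)) (ennreal (1 / (1 - \<tau>))) (pverts G) (adjacency G) ^ (2 * (a * b))
      \<le> of_nat (hom_count (one_subdivision H) G)" if "pair_graph G" for G :: "'g pair_pre_digraph"
    unfolding \<tau>_def by (rule op_norm_adjacency_le_hom_count[OF H fin UV ab that])
  then show "op_norm_certificate TYPE('g) (one_subdivision H)"
    unfolding op_norm_certificate_def Let_def v e exps
    using pair_graph_one_subdivision bipartite_one_subdivision \<open>pair_graph H\<close> ve by auto
qed

theorem corollary2p6:
  shows "(\<forall>a b :: nat. a \<ge> 2 \<longrightarrow> b \<ge> 2 \<longrightarrow>
            (\<forall>H :: 'f pair_pre_digraph. complete_bipartite_digraph a b (with_proj H) \<longrightarrow>
               op_norm_certificate TYPE('g) (one_subdivision H)))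
       \<and> (\<forall>t :: nat. t \<ge> 2 \<longrightarrow>
            (\<forall>H :: 'f pair_pre_digraph. complete_bipartite_digraph t t (with_proj H) \<longrightarrow>
               (\<forall>G :: 'g pair_pre_digraph. pair_graph G \<longrightarrow>
                  of_nat (hom_count (one_subdivision H) G) \<ge>
                    op_norm (ennreal (4 * real t / (3 * real t - 2)))
                            (ennreal (4 * real t / (real t + 2)))
                            (pverts G) (adjacency G) ^ (2 * t\<^sup>2))))"
proof (intro conjI allI impI)
  fix a b :: nat and H :: "'f pair_pre_digraph"
  assume "a \<ge> 2" "b \<ge> 2" "complete_bipartite_digraph a b (with_proj H)"
  then show "op_norm_certificate TYPE('g) (one_subdivision H)"
    by (rule op_norm_certificate_one_subdivision_complete_bipartite)
next
  fix t :: nat and H :: "'f pair_pre_digraph" and G :: "'g pair_pre_digraph"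
  assume t: "t \<ge> 2" and K: "complete_bipartite_digraph t t (with_proj H)" and G: "pair_graph G"
  note cert = op_norm_certificate_one_subdivision_complete_bipartite[OF t t K]
  have exps: "2 * real (2 * (t * t)) / real (t + t + t * t) = 4 * real t / (real t + 2)"
    "2 * real (2 * (t * t)) / (2 * real (2 * (t * t)) - real (t + t + t * t))
      = 4 * real t / (3 * real t - 2)"
  proof -
    have "real t \<ge> 2" using t by simp
    \<comment> \<open>A common factor \<open>t\<close>, nonzero here, is pulled out of
      \<open>v\<close>, \<open>2 * e - v\<close> and \<open>2 * e\<close> and then
      cancelled.\<close>
    moreover have "real (t + t + t * t) = real t * (real t + 2)"
      "2 * real (2 * (t * t)) - real (t + t + t * t) = real t * (3 * real t - 2)"
      "2 * real (2 * (t * t)) = real t * (4 * real t)"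
      by (simp_all add: algebra_simps)
    ultimately show "2 * real (2 * (t * t)) / real (t + t + t * t) = 4 * real t / (real t + 2)"
      "2 * real (2 * (t * t)) / (2 * real (2 * (t * t)) - real (t + t + t * t))
        = 4 * real t / (3 * real t - 2)"
      by (simp_all only: mult_divide_mult_cancel_left_if) auto
  qed
  show "of_nat (hom_count (one_subdivision H) G) \<ge>
      op_norm (ennreal (4 * real t / (3 * real t - 2))) (ennreal (4 * real t / (real t + 2)))
        (pverts G) (adjacency G) ^ (2 * t\<^sup>2)"
    using cert(1)[where 'g = 'g] G
    unfolding op_norm_certificate_def Let_def cert(2,3) exps by (simp add: power2_eq_square)
qed

end
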